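(* Let $n\ge 1$. Every monotone path system in the graph $\mathcal{J}_n$ is strictly metric.
   Context: $\mathcal{J}_n$ is the graph whose vertex set is the disjoint union of $\{x_1,\dots,x_n\}$ and $\{y_1,\dots,y_n\}$, in which the only pairs of non-adjacent distinct vertices are $x_i,x_j$ with $1\le i<j\le n$ (all pairs $y_k,y_l$ and $x_i,y_k$ are adjacent). A consistent path system $\mathcal{P}$ in a graph $G=(V,E)$ is a collection of simple paths in $G$ with exactly one path $P_{u,v}=P_{v,u}$ in $\mathcal{P}$ between any two distinct vertices $u,v$, such that the non-empty intersection of any two paths in $\mathcal{P}$ is either a single vertex or a path in $\mathcal{P}$. It is neighborly if $P_{u,v}$ is the edge $uv$ whenever $uv\in E$. Its diameter is the largest length (number of edges) of a path in it. It is strictly metric if there is $w:E\to\mathbb{R}_{>0}$ such that each path in $\mathcal{P}$ is the unique $w$-shortest path in $G$ between its end vertices. The path systems considered in $\mathcal{J}_n$ are the neighborly ones of diameter 2 of the following form: every adjacent pair is joined by its edge, and for every pair $i\ne j$ in $\{1,\dots,n\}$ there is an index $m_{ij}=m_{ji}\in\{1,\dots,n\}$ with $P_{x_i,x_j}=x_i\,y_{m_{ij}}\,x_j$. (All such systems are consistent.) Such a path system is called monotone if for every $i$ the entries $m_{ij}$, $j\neq i$, are non-decreasing in $j$, i.e. $m_{ij}\le m_{ik}$ whenever $j\le k$ and $j,k\ne i$. *)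

theory Defs
  imports Complex_Main
begin

text \<open>
  A finite simple graph is given by its vertex set \<open>V\<close> and its edge set \<open>E\<close>, a set of two-element
  subsets of \<open>V\<close>. A path is the non-empty list of its vertices in the order of traversal, so that
  an unoriented path is a list up to reversal.
\<close>

definition simple_graph :: "'a set \<Rightarrow> 'a set set \<Rightarrow> bool" where
  "simple_graph V E \<longleftrightarrow> finite V \<and> (\<forall>e\<in>E. e \<subseteq> V \<and> card e = 2)"

definition path_edges :: "'a list \<Rightarrow> 'a set set" where
  "path_edges p = {{p ! i, p ! Suc i} | i. Suc i < length p}"

definition simple_path :: "'a set \<Rightarrow> 'a set set \<Rightarrow> 'a list \<Rightarrow> bool" where
  "simple_path V E p \<longleftrightarrow> p \<noteq> [] \<and> distinct p \<and> set p \<subseteq> V \<and> path_edges p \<subseteq> E"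

definition path_between :: "'a set \<Rightarrow> 'a set set \<Rightarrow> 'a \<Rightarrow> 'a \<Rightarrow> 'a list \<Rightarrow> bool" where
  "path_between V E u v p \<longleftrightarrow> simple_path V E p \<and> hd p = u \<and> last p = v"

text \<open>
  The path \<open>P u v\<close> is listed from \<open>u\<close> to \<open>v\<close>; since it is the same path as \<open>P v u\<close>, the two lists
  are reversals of each other. The values of \<open>P\<close> outside distinct pairs of vertices are irrelevant.
\<close>

definition path_system :: "'a set \<Rightarrow> 'a set set \<Rightarrow> ('a \<Rightarrow> 'a \<Rightarrow> 'a list) \<Rightarrow> bool" where
  "path_system V E P \<longleftrightarrow>
     (\<forall>u\<in>V. \<forall>v\<in>V. u \<noteq> v \<longrightarrow> path_between V E u v (P u v) \<and> P v u = rev (P u v))"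

text \<open>Paths are intersected as subgraphs, that is, both in their vertices and in their edges.\<close>

definition consistent_path_system :: "'a set \<Rightarrow> 'a set set \<Rightarrow> ('a \<Rightarrow> 'a \<Rightarrow> 'a list) \<Rightarrow> bool" where
  "consistent_path_system V E P \<longleftrightarrow> path_system V E P \<and>
     (\<forall>u\<in>V. \<forall>v\<in>V. \<forall>u'\<in>V. \<forall>v'\<in>V. u \<noteq> v \<longrightarrow> u' \<noteq> v' \<longrightarrow>
        set (P u v) \<inter> set (P u' v') \<noteq> {} \<longrightarrow>
        (\<exists>z. set (P u v) \<inter> set (P u' v') = {z}) \<or>
        (\<exists>a\<in>V. \<exists>b\<in>V. a \<noteq> b \<and>
           set (P u v) \<inter> set (P u' v') = set (P a b) \<and>
           path_edges (P u v) \<inter> path_edges (P u' v') = path_edges (P a b)))"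

definition neighborly :: "'a set \<Rightarrow> 'a set set \<Rightarrow> ('a \<Rightarrow> 'a \<Rightarrow> 'a list) \<Rightarrow> bool" where
  "neighborly V E P \<longleftrightarrow> (\<forall>u\<in>V. \<forall>v\<in>V. {u, v} \<in> E \<longrightarrow> P u v = [u, v])"

definition diameter :: "'a set \<Rightarrow> ('a \<Rightarrow> 'a \<Rightarrow> 'a list) \<Rightarrow> nat" where
  "diameter V P = Max {length (P u v) - 1 | u v. u \<in> V \<and> v \<in> V \<and> u \<noteq> v}"

text \<open>A simple path traverses each of its edges once, so its weight is a sum over a set of edges.\<close>

definition path_weight :: "('a set \<Rightarrow> real) \<Rightarrow> 'a list \<Rightarrow> real" where
  "path_weight w p = (\<Sum>e\<in>path_edges p. w e)"

definition strictly_metric :: "'a set \<Rightarrow> 'a set set \<Rightarrow> ('a \<Rightarrow> 'a \<Rightarrow> 'a list) \<Rightarrow> bool" where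
  "strictly_metric V E P \<longleftrightarrow>
     (\<exists>w. (\<forall>e\<in>E. w e > 0) \<and>
        (\<forall>u\<in>V. \<forall>v\<in>V. u \<noteq> v \<longrightarrow>
           (\<forall>q. path_between V E u v q \<and> q \<noteq> P u v \<longrightarrow> path_weight w (P u v) < path_weight w q)))"

datatype jvertex = VX nat | VY nat

definition J_verts :: "nat \<Rightarrow> jvertex set" where
  "J_verts n = VX ` {1..n} \<union> VY ` {1..n}"

definition J_edges :: "nat \<Rightarrow> jvertex set set" where
  "J_edges n = {{u, v} | u v. u \<in> J_verts n \<and> v \<in> J_verts n \<and> u \<noteq> v \<and>
                              \<not> (u \<in> range VX \<and> v \<in> range VX)}"

definition J_system :: "nat \<Rightarrow> (nat \<Rightarrow> nat \<Rightarrow> nat) \<Rightarrow> (jvertex \<Rightarrow> jvertex \<Rightarrow> jvertex list) \<Rightarrow> bool" where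
  "J_system n m P \<longleftrightarrow>
     path_system (J_verts n) (J_edges n) P \<and> neighborly (J_verts n) (J_edges n) P \<and>
     (\<forall>i\<in>{1..n}. \<forall>j\<in>{1..n}. i \<noteq> j \<longrightarrow>
        m i j \<in> {1..n} \<and> m i j = m j i \<and> P (VX i) (VX j) = [VX i, VY (m i j), VX j])"

definition monotone_path_system :: "nat \<Rightarrow> (jvertex \<Rightarrow> jvertex \<Rightarrow> jvertex list) \<Rightarrow> bool" where
  "monotone_path_system n P \<longleftrightarrow>
     (\<exists>m. J_system n m P \<and>
        (\<forall>i\<in>{1..n}. \<forall>j\<in>{1..n} - {i}. \<forall>k\<in>{1..n} - {i}. j \<le> k \<longrightarrow> m i j \<le> m i k))"

lemma simple_graph_J: "simple_graph (J_verts n) (J_edges n)"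
  unfolding simple_graph_def J_edges_def by (auto simp: J_verts_def)

lemma path_edges_2: "path_edges [u, v] = {{u, v}}"
  unfolding path_edges_def by (auto simp: less_Suc_eq)

lemma path_edges_3: "path_edges [u, v, w] = {{u, v}, {v, w}}"
proof -
  have "path_edges [u, v, w] = (\<lambda>i. {[u, v, w] ! i, [u, v, w] ! Suc i}) ` {i. i < 2}"
    unfolding path_edges_def by auto
  also have "{i. i < 2} = {0, Suc 0}" by auto
  finally show ?thesis by simp
qed

lemma J_system_cases:
  assumes "J_system n m P" "u \<in> J_verts n" "v \<in> J_verts n" "u \<noteq> v"
  obtains (edge) "{u, v} \<in> J_edges n" "P u v = [u, v]"
  | (two) i j where "i \<in> {1..n}" "j \<in> {1..n}" "i \<noteq> j" "u = VX i" "v = VX j"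
      "m i j \<in> {1..n}" "m i j = m j i" "P u v = [VX i, VY (m i j), VX j]"
proof (cases "u \<in> range VX \<and> v \<in> range VX")
  case True
  then obtain i j where ij: "i \<in> {1..n}" "j \<in> {1..n}" "u = VX i" "v = VX j"
    using assms(2,3) by (auto simp: J_verts_def)
  with assms(4) have ne: "i \<noteq> j" by blast
  have "m i j \<in> {1..n} \<and> m i j = m j i \<and> P (VX i) (VX j) = [VX i, VY (m i j), VX j]"
    using assms(1) ij(1,2) ne unfolding J_system_def by blast
  then show ?thesis using two[OF ij(1,2) ne ij(3,4)] ij(3,4) by blast
next
  case False
  then have "{u, v} \<in> J_edges n" using assms unfolding J_edges_def by blast
  moreover from this have "P u v = [u, v]"
    using assms(1-3) unfolding J_system_def neighborly_def by blast
  ultimately show ?thesis by (rule edge)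
qed

lemma J_system_diameter:
  assumes "J_system n m P" "n \<ge> 2"
  shows "diameter (J_verts n) P = 2"
proof -
  let ?L = "{length (P u v) - 1 | u v. u \<in> J_verts n \<and> v \<in> J_verts n \<and> u \<noteq> v}"
  have le: "l \<le> 2" if "l \<in> ?L" for l
  proof -
    from that obtain u v where uv: "u \<in> J_verts n" "v \<in> J_verts n" "u \<noteq> v"
      and l: "l = length (P u v) - 1" by blast
    show ?thesis using assms(1) uv by (cases rule: J_system_cases) (simp_all add: l)
  qed
  have "VX 1 \<in> J_verts n" "VX 2 \<in> J_verts n"
    using assms(2) by (auto simp: J_verts_def)
  moreover have "P (VX 1) (VX 2) = [VX 1, VY (m 1 2), VX 2]"
    using assms by (auto simp: J_system_def)
  ultimately have "2 \<in> ?L"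
    by (intro CollectI exI[of _ "VX 1"] exI[of _ "VX 2"]) simp
  moreover have "finite ?L"
    using le by (meson finite_nat_set_iff_bounded_le)
  ultimately show ?thesis
    unfolding diameter_def using le by (intro Max_eqI) auto
qed

lemma J_system_consistent:
  assumes J: "J_system n m P"
  shows "consistent_path_system (J_verts n) (J_edges n) P"
proof -
  let ?V = "J_verts n" and ?E = "J_edges n"
  define good where "good A B F G \<longleftrightarrow> A \<inter> B = {} \<or> (\<exists>z. A \<inter> B = {z}) \<or>
    (\<exists>a\<in>?V. \<exists>b\<in>?V. a \<noteq> b \<and> A \<inter> B = set (P a b) \<and> F \<inter> G = path_edges (P a b))" for A B F G
  have ps: "path_system ?V ?E P" and nb: "neighborly ?V ?E P"
    using J by (auto simp: J_system_def)
  have edge: "P (VX i) (VY k) = [VX i, VY k]" "VX i \<in> ?V" "VY k \<in> ?V"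
    if "i \<in> {1..n}" "k \<in> {1..n}" for i k
  proof -
    show *: "VX i \<in> ?V" "VY k \<in> ?V" using that by (auto simp: J_verts_def)
    have "{VX i, VY k} \<in> ?E" using * unfolding J_edges_def by blast
    then show "P (VX i) (VY k) = [VX i, VY k]" using nb * by (auto simp: neighborly_def)
  qed
  have noX: "{VX i, VX j} \<notin> ?E" for i j
    by (auto simp: J_edges_def doubleton_eq_iff)
  have comm: "good A B F G \<longleftrightarrow> good B A G F" for A B F G
    by (simp add: good_def Int_commute)
  have et: "good {a, b} {VX i, VY (m i j), VX j} {{a, b}} {{VX i, VY (m i j)}, {VY (m i j), VX j}}"
    if "a \<in> ?V" "b \<in> ?V" "a \<noteq> b" "{a, b} \<in> ?E" "P a b = [a, b]" for a b i j
  proof (cases "{a, b} \<subseteq> {VX i, VY (m i j), VX j}")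
    case True
    have "{a, b} \<noteq> {VX i, VX j}" using that noX by auto
    with True \<open>a \<noteq> b\<close> have "{a, b} \<in> {{VX i, VY (m i j)}, {VY (m i j), VX j}}" by auto
    then have "{{a, b}} \<inter> {{VX i, VY (m i j)}, {VY (m i j), VX j}} = {{a, b}}" by auto
    moreover have "{a, b} \<inter> {VX i, VY (m i j), VX j} = {a, b}" using True by auto
    ultimately show ?thesis unfolding good_def using that
      by (metis empty_set list.simps(15) path_edges_2)
  next
    case False
    then show ?thesis unfolding good_def by auto
  qed
  have "good (set (P u v)) (set (P u' v')) (path_edges (P u v)) (path_edges (P u' v'))"
    if u: "u \<in> ?V" "v \<in> ?V" "u \<noteq> v" and u': "u' \<in> ?V" "v' \<in> ?V" "u' \<noteq> v'" for u v u' v'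
    using J u
  proof (cases rule: J_system_cases)
    case e: edge
    show ?thesis using J u'
    proof (cases rule: J_system_cases)
      case edge
      consider "{u, v} = {u', v'}" | "{u, v} \<noteq> {u', v'}" by blast
      then show ?thesis
      proof cases
        case 1
        then have "set (P u v) \<inter> set (P u' v') = set (P u v)"
          "path_edges (P u v) \<inter> path_edges (P u' v') = path_edges (P u v)"
          using e edge by (simp_all add: path_edges_2)
        then show ?thesis unfolding good_def using u by blast
      next
        case 2
        then show ?thesis unfolding good_def using e edge u(3) u'(3) by auto
      qed
    next
      case (two i j)
      then show ?thesis using et[OF u e, of i j] by (simp only: two(8) e(2) path_edges_2 path_edges_3 list.set)
    qed
  next
    case t: (two i j)
    show ?thesis using J u'
    proof (cases rule: J_system_cases)
      case edge
      then show ?thesis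
        using et[OF u' edge, of i j, THEN comm[THEN iffD1]]
        by (simp only: t(8) edge(2) path_edges_2 path_edges_3 list.set)
    next
      case (two i' j')
      show ?thesis
      proof (cases "{i, j} = {i', j'}")
        case True
        then have k: "m i' j' = m i j" using t(7) by (auto simp: doubleton_eq_iff)
        have "set (P u v) \<inter> set (P u' v') = set (P u v)"
          "path_edges (P u v) \<inter> path_edges (P u' v') = path_edges (P u v)"
          using t(8)[folded k] two(8) True by (auto simp: path_edges_3 doubleton_eq_iff)
        then show ?thesis unfolding good_def using u by blast
      next
        case ne: False
        show ?thesis
        proof (cases "m i j = m i' j' \<and> {i, j} \<inter> {i', j'} \<noteq> {}")
          case True
          then obtain l where l: "l \<in> {i, j}" "l \<in> {i', j'}" by blast
          let ?k = "m i j"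
          have "set (P u v) \<inter> set (P u' v') = {VX l, VY ?k}"
            using l ne True t(3,8) two(3,8) by auto
          moreover have "path_edges (P u v) \<inter> path_edges (P u' v') = {{VX l, VY ?k}}"
            using l ne True t(3,8) two(3,8) by (auto simp: path_edges_3 doubleton_eq_iff)
          moreover have "l \<in> {1..n}" "?k \<in> {1..n}" using l t by auto
          ultimately show ?thesis unfolding good_def using edge[of l ?k]
            by (intro disjI2 bexI[of _ "VX l"] bexI[of _ "VY ?k"]) (auto simp: path_edges_2)
        next
          case False
          then show ?thesis unfolding good_def using ne t(3,8) two(3,8) by auto
        qed
      qed
    qed
  qed
  then show ?thesis
    unfolding consistent_path_system_def good_def using ps by blast
qed

end

theory Submission
  imports Defs
begin

text \<open>
  If all edge weights lie close to a common value, an edge is the only shortest path between its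
  ends, and every path of length at least 3 is heavier than every path of length 2. The weighting
  sought is therefore a small perturbation of a constant: \<open>y\<^sub>k y\<^sub>l\<close> has weight \<open>6 M\<close> and
  \<open>x\<^sub>i y\<^sub>k\<close> has weight \<open>6 M + a i k\<close> with \<open>\<bar>a i k\<bar> \<le> M\<close>. Only paths of length 2 can then compete
  with \<open>x\<^sub>i y\<^sub>m x\<^sub>j\<close>, where \<open>m = m\<^sub>i\<^sub>j\<close>, and the theorem is reduced to finding reals \<open>a i k\<close> for
  which \<open>a i k + a j k\<close> has its unique minimum over \<open>k\<close> at \<open>k = m\<^sub>i\<^sub>j\<close>.

  It is enough that \<open>a i k + a j k\<close> strictly decreases in \<open>k\<close> up to \<open>m\<^sub>i\<^sub>j\<close> and strictly increases
  afterwards. With the increments \<open>d k i = a i (k + 1) - a i k\<close>, this says that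
  \<open>d k i + d k j\<close> is positive if \<open>m\<^sub>i\<^sub>j \<le> k\<close> and negative otherwise. The conditions for different
  \<open>k\<close> are independent of each other. For fixed \<open>k\<close> they ask for vertex values that realise the
  graph \<open>{ij. m\<^sub>i\<^sub>j \<le> k}\<close> as a threshold graph. Monotonicity says exactly that every neighbourhood
  in this graph is an initial segment of the other vertices, and such graphs are threshold graphs
  (lemma \<open>threshold_realization\<close>).
\<close>

section \<open>Threshold graphs and separable minima\<close>

text \<open>
  The smallest vertex \<open>a\<close> and the largest vertex \<open>b\<close> decide the induction: if they are related, then
  \<open>a\<close> is related to everything, otherwise \<open>b\<close> is related to nothing. Such a vertex can be removed
  and afterwards be given a value that outweighs all the others.
\<close>

lemma threshold_realization:
  fixes R :: "'a::linorder \<Rightarrow> 'a \<Rightarrow> bool"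
  assumes "finite S"
    and "\<And>i j. i \<in> S \<Longrightarrow> j \<in> S \<Longrightarrow> R i j \<Longrightarrow> R j i"
    and "\<And>i j k. \<lbrakk>i \<in> S; j \<in> S; k \<in> S; i \<noteq> j; i \<noteq> k; j \<le> k; R i k\<rbrakk> \<Longrightarrow> R i j"
  shows "\<exists>d :: 'a \<Rightarrow> real. \<forall>i\<in>S. \<forall>j\<in>S. i \<noteq> j \<longrightarrow>
           (R i j \<longrightarrow> d i + d j > 0) \<and> (\<not> R i j \<longrightarrow> d i + d j < 0)"
  using assms
proof (induction S rule: finite_psubset_induct)
  case (psubset S)
  note sym = psubset.prems(1) and mono = psubset.prems(2)
  show ?case
  proof (cases "S = {}")
    case False
    define a b where "a = Min S" and "b = Max S"
    have ab: "a \<in> S" "b \<in> S" "\<And>i. i \<in> S \<Longrightarrow> a \<le> i \<and> i \<le> b"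
      using False psubset.hyps by (auto simp: a_def b_def)
    define c where "c = (if R a b then a else b)"
    have c: "c \<in> S" using ab by (simp add: c_def)
    have "\<exists>d :: 'a \<Rightarrow> real. \<forall>i\<in>S - {c}. \<forall>j\<in>S - {c}. i \<noteq> j \<longrightarrow>
           (R i j \<longrightarrow> d i + d j > 0) \<and> (\<not> R i j \<longrightarrow> d i + d j < 0)"
    proof (rule psubset.IH)
      show "S - {c} \<subset> S" using c by blast
      show "R j i" if "i \<in> S - {c}" "j \<in> S - {c}" "R i j" for i j
        using sym that by blast
      show "R i j" if "i \<in> S - {c}" "j \<in> S - {c}" "k \<in> S - {c}" "i \<noteq> j" "i \<noteq> k" "j \<le> k" "R i k"
        for i j k
        using mono[of i j k] that by simp
    qed
    then obtain d :: "'a \<Rightarrow> real" where d: "\<And>i j. \<lbrakk>i \<in> S - {c}; j \<in> S - {c}; i \<noteq> j\<rbrakk> \<Longrightarrow>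
           (R i j \<longrightarrow> d i + d j > 0) \<and> (\<not> R i j \<longrightarrow> d i + d j < 0)"
      by blast
    define B where "B = 1 + (\<Sum>i\<in>S. \<bar>d i\<bar>)"
    have B: "\<bar>d i\<bar> < B" if "i \<in> S" for i
      using member_le_sum[of i S "\<lambda>i. \<bar>d i\<bar>"] psubset.hyps that by (simp add: B_def)
    have R_c: "R c i = R a b \<and> R i c = R a b" if i: "i \<in> S" "i \<noteq> c" for i
    proof (cases "R a b")
      case True
      then have c_a: "c = a" by (simp add: c_def)
      then have "a \<noteq> b" using ab(3)[OF i(1)] i(2) by auto
      then have "R c i" using mono[of a i b] ab i True c_a by auto
      with True show ?thesis using sym[OF c i(1)] by simp
    next
      case False
      have "\<not> R i b"
      proof
        assume "R i b"
        moreover have "i \<noteq> b" using False i by (simp add: c_def)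
        moreover have "a \<noteq> b" using ab(3)[OF i(1)] calculation(2) by auto
        ultimately have "R b a" using mono[of b a i] sym[of i b] ab i by auto
        with False sym[OF ab(2,1)] show False by simp
      qed
      moreover have "c = b" using False by (simp add: c_def)
      ultimately show ?thesis using False sym[OF c i(1)] by auto
    qed
    let ?d = "d(c := if R a b then B else - B)"
    have "(R i j \<longrightarrow> ?d i + ?d j > 0) \<and> (\<not> R i j \<longrightarrow> ?d i + ?d j < 0)"
      if "i \<in> S" "j \<in> S" "i \<noteq> j" for i j
      using that d[of i j] B[of i] B[of j] R_c[of i] R_c[of j]
      by (cases "i = c"; cases "j = c") auto
    then show ?thesis by (intro exI[of _ ?d] ballI impI)
  qed simp
qed

text \<open>
  The increments \<open>d l i = a i (l + 1) - a i l\<close> come from a threshold realization for each level \<open>l\<close>,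
  so that \<open>a i k + a j k\<close> falls in \<open>k\<close> as long as \<open>k < m i j\<close> and rises from there on.
\<close>

lemma threshold_sums_unique_minimum:
  fixes m :: "'a::linorder \<Rightarrow> 'a \<Rightarrow> nat"
  assumes "finite S"
    and sym: "\<And>i j. i \<in> S \<Longrightarrow> j \<in> S \<Longrightarrow> i \<noteq> j \<Longrightarrow> m i j = m j i"
    and mono: "\<And>i j k. \<lbrakk>i \<in> S; j \<in> S; k \<in> S; i \<noteq> j; i \<noteq> k; j \<le> k\<rbrakk> \<Longrightarrow> m i j \<le> m i k"
  obtains a :: "'a \<Rightarrow> nat \<Rightarrow> real" where
    "\<And>i j k. \<lbrakk>i \<in> S; j \<in> S; i \<noteq> j; k \<noteq> m i j\<rbrakk> \<Longrightarrow> a i (m i j) + a j (m i j) < a i k + a j k"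
proof -
  have "\<exists>d :: 'a \<Rightarrow> real. \<forall>i\<in>S. \<forall>j\<in>S. i \<noteq> j \<longrightarrow>
      (m i j \<le> l \<longrightarrow> d i + d j > 0) \<and> (\<not> m i j \<le> l \<longrightarrow> d i + d j < 0)" for l
  proof (rule threshold_realization[OF \<open>finite S\<close>])
    fix i j assume "i \<in> S" "j \<in> S" "m i j \<le> l"
    then show "m j i \<le> l" using sym[of i j] by (cases "i = j") auto
  next
    fix i j k assume "i \<in> S" "j \<in> S" "k \<in> S" "i \<noteq> j" "i \<noteq> k" "j \<le> k" "m i k \<le> l"
    then show "m i j \<le> l" using mono[of i j k] by auto
  qed
  then obtain d :: "nat \<Rightarrow> 'a \<Rightarrow> real"
    where d: "\<And>l. \<forall>i\<in>S. \<forall>j\<in>S. i \<noteq> j \<longrightarrow> (m i j \<le> l \<longrightarrow> d l i + d l j > 0) \<and>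
      (\<not> m i j \<le> l \<longrightarrow> d l i + d l j < 0)"
    by moura
  have pos: "d l i + d l j > 0" if "i \<in> S" "j \<in> S" "i \<noteq> j" "m i j \<le> l" for l i j
    using d[of l] that by blast
  have neg: "d l i + d l j < 0" if "i \<in> S" "j \<in> S" "i \<noteq> j" "l < m i j" for l i j
    using d[of l] that by (meson leD)
  define a where "a i k = (\<Sum>l<k. d l i)" for i k
  have diff: "a i q + a j q = a i p + a j p + (\<Sum>l=p..<q. d l i + d l j)" if "p \<le> q" for i j p q
  proof -
    have "a h q = a h p + (\<Sum>l=p..<q. d l h)" for h
      unfolding a_def lessThan_atLeast0 using that by (simp add: sum.atLeastLessThan_concat)
    then show ?thesis by (simp add: sum.distrib)
  qed
  have "a i (m i j) + a j (m i j) < a i k + a j k"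
    if ij: "i \<in> S" "j \<in> S" "i \<noteq> j" and k: "k \<noteq> m i j" for i j k
  proof (cases "k < m i j")
    case True
    then have "(\<Sum>l=k..<m i j. d l i + d l j) < (\<Sum>l=k..<m i j. 0)"
      using neg[OF ij] by (intro sum_strict_mono) auto
    then show ?thesis using diff[of k "m i j" i j] True by simp
  next
    case False
    then have "(\<Sum>l=m i j..<k. d l i + d l j) > 0"
      using pos[OF ij] k by (intro sum_pos) auto
    then show ?thesis using diff[of "m i j" k i j] False by simp
  qed
  then show thesis by (rule that)
qed

section \<open>Nearly constant weights\<close>

lemma card_path_edges:
  assumes "distinct p"
  shows "finite (path_edges p)" "card (path_edges p) = length p - 1"
proof -
  have eq: "path_edges p = (\<lambda>i. {p ! i, p ! Suc i}) ` {..<length p - 1}"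
    by (auto simp: path_edges_def)
  have "inj_on (\<lambda>i. {p ! i, p ! Suc i}) {..<length p - 1}"
    using assms by (auto simp: inj_on_def doubleton_eq_iff nth_eq_iff_index_eq)
  then show "finite (path_edges p)" "card (path_edges p) = length p - 1"
    unfolding eq by (simp_all add: card_image)
qed

lemma path_weight_lower_bound:
  assumes "simple_path V E p" "\<And>e. e \<in> E \<Longrightarrow> c \<le> w e"
  shows "real (length p - 1) * c \<le> path_weight w p"
proof -
  have "(\<Sum>e\<in>path_edges p. c) \<le> path_weight w p"
    unfolding path_weight_def using assms by (intro sum_mono) (auto simp: simple_path_def)
  then show ?thesis
    using assms(1) card_path_edges[of p] by (simp add: simple_path_def)
qed

lemma path_between_length_2:
  assumes "path_between V E u v q" "length q = 2"
  shows "q = [u, v]" "{u, v} \<in> E"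
proof -
  obtain a b where "q = [a, b]" using assms(2) by (auto simp: length_Suc_conv numeral_2_eq_2)
  with assms show "q = [u, v]" "{u, v} \<in> E"
    by (auto simp: path_between_def simple_path_def path_edges_2)
qed

lemma path_between_length_3:
  assumes "path_between V E u v q" "length q = 3"
  obtains z where "q = [u, z, v]" "{u, z} \<in> E" "{z, v} \<in> E" "z \<in> V"
proof -
  obtain a b c where "q = [a, b, c]" using assms(2) by (auto simp: length_Suc_conv numeral_3_eq_3)
  with assms that[of b] show thesis
    by (auto simp: path_between_def simple_path_def path_edges_3)
qed

lemma path_weight_3:
  assumes "u \<noteq> v"
  shows "path_weight w [u, z, v] = w {u, z} + w {z, v}"
proof -
  have "{u, z} \<noteq> {z, v}" using assms by (auto simp: doubleton_eq_iff)
  then show ?thesis by (simp add: path_weight_def path_edges_3)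
qed

lemma J_edge_XY:
  assumes "i \<in> {1..n}" "k \<in> {1..n}"
  shows "{VX i, VY k} \<in> J_edges n"
proof -
  have "VX i \<in> J_verts n \<and> VY k \<in> J_verts n \<and> VX i \<noteq> VY k \<and> VY k \<notin> range VX"
    using assms by (auto simp: J_verts_def)
  then show ?thesis
    unfolding J_edges_def mem_Collect_eq by (intro exI[of _ "VX i"] exI[of _ "VY k"]) simp
qed

text \<open>
  Lengths settle all comparisons except those between two paths of length 2: one edge weighs at most
  \<open>7 M < 2 \<cdot> 5 M\<close>, and two edges weigh at most \<open>2 \<cdot> 7 M < 3 \<cdot> 5 M\<close>.
\<close>

lemma strictly_metric_J_criterion:
  fixes w :: "jvertex set \<Rightarrow> real"
  assumes J: "J_system n m P" and "M > 0"
    and w: "\<And>e. e \<in> J_edges n \<Longrightarrow> 5 * M \<le> w e \<and> w e \<le> 7 * M"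
    and mid: "\<And>i j k. \<lbrakk>i \<in> {1..n}; j \<in> {1..n}; i \<noteq> j; k \<in> {1..n}; k \<noteq> m i j\<rbrakk> \<Longrightarrow>
      w {VX i, VY (m i j)} + w {VY (m i j), VX j} < w {VX i, VY k} + w {VY k, VX j}"
  shows "strictly_metric (J_verts n) (J_edges n) P"
proof -
  have "path_weight w (P u v) < path_weight w q"
    if u: "u \<in> J_verts n" "v \<in> J_verts n" "u \<noteq> v"
      and q: "path_between (J_verts n) (J_edges n) u v q" and ne: "q \<noteq> P u v" for u v q
  proof -
    have heavy: "real (length q - 1) * (5 * M) \<le> path_weight w q"
      using q w by (intro path_weight_lower_bound) (auto simp: path_between_def)
    have heavier: "real l * (5 * M) \<le> path_weight w q" if "l < length q" for l
      by (rule order_trans[OF mult_right_mono heavy]) (use that \<open>M > 0\<close> in auto)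
    have "length q \<noteq> 0" "length q \<noteq> 1"
      using q u(3) by (auto simp: path_between_def simple_path_def length_Suc_conv)
    then have len: "length q \<ge> 2" by linarith
    show ?thesis using J u
    proof (cases rule: J_system_cases)
      case edge
      have "length q \<noteq> 2" using path_between_length_2[OF q] edge ne by auto
      then have "real 2 * (5 * M) \<le> path_weight w q" using len heavier[of 2] by simp
      moreover have "path_weight w (P u v) \<le> 7 * M"
        using w edge by (simp add: path_weight_def path_edges_2)
      ultimately show ?thesis using \<open>M > 0\<close> by simp
    next
      case (two i j)
      have noX: "{VX i', VX j'} \<notin> J_edges n" for i' j'
        by (auto simp: J_edges_def doubleton_eq_iff)
      have Puv: "path_weight w (P u v) = w {VX i, VY (m i j)} + w {VY (m i j), VX j}"
        using two by (simp add: path_weight_3)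
      have "length q \<noteq> 2" using path_between_length_2[OF q] two noX by auto
      show ?thesis
      proof (cases "length q = 3")
        case True
        then obtain z where z: "q = [u, z, v]" "{u, z} \<in> J_edges n" "z \<in> J_verts n"
          by (rule path_between_length_3[OF q])
        with noX two obtain k where k: "z = VY k" "k \<in> {1..n}"
          by (auto simp: J_verts_def)
        then have "k \<noteq> m i j" using ne z two by auto
        then show ?thesis using mid[of i j k] z k two Puv by (simp add: path_weight_3)
      next
        case False
        then have "real 3 * (5 * M) \<le> path_weight w q"
          using len \<open>length q \<noteq> 2\<close> by (intro heavier) linarith
        moreover have "{VX i, VY (m i j)} \<in> J_edges n" "{VY (m i j), VX j} \<in> J_edges n"
          using J_edge_XY[of i n "m i j"] J_edge_XY[of j n "m i j"] two by (simp_all add: insert_commute)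
        then have "path_weight w (P u v) \<le> 2 * (7 * M)"
          using w[of "{VX i, VY (m i j)}"] w[of "{VY (m i j), VX j}"] unfolding Puv by linarith
        ultimately show ?thesis using \<open>M > 0\<close> by simp
      qed
    qed
  qed
  moreover have "w e > 0" if "e \<in> J_edges n" for e using w[OF that] \<open>M > 0\<close> by simp
  ultimately show ?thesis unfolding strictly_metric_def by blast
qed

section \<open>Monotone path systems\<close>

theorem theorem5p8:
  fixes n :: nat and P :: "jvertex \<Rightarrow> jvertex \<Rightarrow> jvertex list"
  assumes "n \<ge> 1"
    and "monotone_path_system n P"
  shows "strictly_metric (J_verts n) (J_edges n) P"
proof -
  obtain m where J: "J_system n m P"
    and mono: "\<forall>i\<in>{1..n}. \<forall>j\<in>{1..n} - {i}. \<forall>k\<in>{1..n} - {i}. j \<le> k \<longrightarrow> m i j \<le> m i k"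
    using assms(2) unfolding monotone_path_system_def by blast
  have sym: "m i j = m j i" if "i \<in> {1..n}" "j \<in> {1..n}" "i \<noteq> j" for i j
    using J that unfolding J_system_def by blast
  obtain a :: "nat \<Rightarrow> nat \<Rightarrow> real"
    where a: "\<And>i j k. \<lbrakk>i \<in> {1..n}; j \<in> {1..n}; i \<noteq> j; k \<noteq> m i j\<rbrakk> \<Longrightarrow>
      a i (m i j) + a j (m i j) < a i k + a j k"
  proof (rule threshold_sums_unique_minimum[of "{1..n}" m])
    show "m i j \<le> m i k" if "i \<in> {1..n}" "j \<in> {1..n}" "k \<in> {1..n}" "i \<noteq> j" "i \<noteq> k" "j \<le> k"
      for i j k using mono that by blast
  qed (use sym in auto)
  define M where "M = 1 + (\<Sum>(i, k)\<in>{1..n} \<times> {1..n}. \<bar>a i k\<bar>)"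
  have "M > 0" unfolding M_def by (intro add_pos_nonneg sum_nonneg) auto
  have a_le: "\<bar>a i k\<bar> \<le> M" if "i \<in> {1..n}" "k \<in> {1..n}" for i k
    using member_le_sum[of "(i, k)" "{1..n} \<times> {1..n}" "\<lambda>(i, k). \<bar>a i k\<bar>"] that
    by (auto simp: M_def)
  \<comment> \<open>The sum has one term if \<open>e\<close> joins an \<open>x\<close> to a \<open>y\<close>, and none if \<open>e\<close> joins two \<open>y\<close>s.\<close>
  define w where "w e = 6 * M + (\<Sum>(i, k) | e = {VX i, VY k}. a i k)" for e
  have wXY: "w {VX i, VY k} = 6 * M + a i k" for i k
  proof -
    have "{(i', k'). {VX i, VY k} = {VX i', VY k'}} = {(i, k)}"
      by (auto simp: doubleton_eq_iff)
    then show ?thesis by (simp add: w_def)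
  qed
  then have wYX: "w {VY k, VX i} = 6 * M + a i k" for i k
    by (simp add: insert_commute)
  have wYY: "w {VY k, VY l} = 6 * M" for k l
    by (simp add: w_def doubleton_eq_iff)
  have "5 * M \<le> w e \<and> w e \<le> 7 * M" if e: "e \<in> J_edges n" for e
  proof -
    obtain u v where "e = {u, v}" "u \<in> J_verts n" "v \<in> J_verts n"
      "\<not> (u \<in> range VX \<and> v \<in> range VX)"
      using e unfolding J_edges_def by blast
    then consider (XY) i k where "i \<in> {1..n}" "k \<in> {1..n}" "e = {VX i, VY k}"
      | (YY) k l where "e = {VY k, VY l}"
      unfolding J_verts_def by blast
    then show ?thesis
    proof cases
      case XY
      then show ?thesis using a_le[of i k] wXY[of i k] by (simp add: abs_le_iff)
    next
      case YY
      then show ?thesis using \<open>M > 0\<close> wYY by simp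
    qed
  qed
  with J \<open>M > 0\<close> show ?thesis
    by (rule strictly_metric_J_criterion) (use a in \<open>auto simp: wXY wYX\<close>)
qed

end
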